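(* As formal power series in $z$, $$F(321,231;q,z)=\frac{1-qz}{1-(1+q)z-(1-q)z^2}.$$
   Context: $S_n$ is the set of permutations of $[n]=\{1,\ldots,n\}$ (with $S_0$ consisting of the empty permutation, which has no crossing). A permutation $\sigma\in S_n$ avoids a pattern $\tau\in S_m$ if no subsequence $\sigma(i_1)\cdots\sigma(i_m)$ with $i_1<\cdots<i_m$ is in the same relative order as $\tau$; $S_n(\tau_1,\tau_2)$ is the set of $\sigma\in S_n$ avoiding both $\tau_1$ and $\tau_2$. A crossing of $\sigma$ is a pair $(i,j)$ with $i<j<\sigma(i)<\sigma(j)$ or $\sigma(i)<\sigma(j)\leq i<j$; $\mathrm{cr}(\sigma)$ is the number of crossings. Put $$F(\tau_1,\tau_2;q,z)=\sum_{n\geq 0}\Big(\sum_{\sigma\in S_n(\tau_1,\tau_2)}q^{\mathrm{cr}(\sigma)}\Big)z^n.$$ *)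

theory Defs
  imports
    "HOL-Combinatorics.Permutations"
    "HOL-Computational_Algebra.Formal_Power_Series"
begin

(* Permutations of [n] are functions with "s permutes {1..n}", so the empty permutation is id.
   Patterns are given in one-line notation, as lists. *)

definition contains_pattern :: "nat \<Rightarrow> (nat \<Rightarrow> nat) \<Rightarrow> nat list \<Rightarrow> bool" where
  "contains_pattern n \<sigma> \<tau> \<longleftrightarrow>
     (\<exists>\<iota> :: nat \<Rightarrow> nat. strict_mono_on {..<length \<tau>} \<iota> \<and> \<iota> ` {..<length \<tau>} \<subseteq> {1..n} \<and>
        (\<forall>a<length \<tau>. \<forall>b<length \<tau>. \<sigma> (\<iota> a) < \<sigma> (\<iota> b) \<longleftrightarrow> \<tau> ! a < \<tau> ! b))"

definition avoiders :: "nat list \<Rightarrow> nat list \<Rightarrow> nat \<Rightarrow> (nat \<Rightarrow> nat) set" where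
  "avoiders \<tau>1 \<tau>2 n =
     {\<sigma>. \<sigma> permutes {1..n} \<and> \<not> contains_pattern n \<sigma> \<tau>1 \<and> \<not> contains_pattern n \<sigma> \<tau>2}"

definition crossings :: "nat \<Rightarrow> (nat \<Rightarrow> nat) \<Rightarrow> (nat \<times> nat) set" where
  "crossings n \<sigma> = {(i, j). i \<in> {1..n} \<and> j \<in> {1..n} \<and>
     (i < j \<and> j < \<sigma> i \<and> \<sigma> i < \<sigma> j \<or> \<sigma> i < \<sigma> j \<and> \<sigma> j \<le> i \<and> i < j)}"

definition cr :: "nat \<Rightarrow> (nat \<Rightarrow> nat) \<Rightarrow> nat" where
  "cr n \<sigma> = card (crossings n \<sigma>)"

(* z is the variable of the power series. The parameter q may be any ring element; the generating
   function with a formal variable q is the instance where q is an indeterminate,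
   e.g. [:0, 1:] in int poly or its image in the fraction field. *)

definition crossing_gf :: "nat list \<Rightarrow> nat list \<Rightarrow> 'a::comm_ring_1 \<Rightarrow> 'a fps" where
  "crossing_gf \<tau>1 \<tau>2 q = Abs_fps (\<lambda>n. \<Sum>\<sigma>\<in>avoiders \<tau>1 \<tau>2 n. q ^ cr n \<sigma>)"

end

(* A permutation avoids 321 and 231 iff every entry is preceded by at most one larger entry.
   Such permutations of [n+1] arise from those of [n] either by appending n+1 as a fixed point, which
   keeps the crossings, or by composing on the left with the transposition of n and n+1, which
   creates the single crossing (n, n+1) unless n was a fixed point. Counting by whether the last
   point is fixed yields a_(n+2) = (1 + q) a_(n+1) + (1 - q) a_n. *)

theory Submission
  imports Defs
begin

declare One_nat_def [simp del]

section \<open>Pattern containment in terms of positions\<close>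

lemma all_less_3_iff: "(\<forall>a<3. P a) \<longleftrightarrow> P 0 \<and> P 1 \<and> P (2::nat)"
  by (auto simp: numeral_3_eq_3 numeral_2_eq_2 One_nat_def less_Suc_eq)

lemma contains_pattern_length3_iff:
  "contains_pattern n \<sigma> [x, y, w] \<longleftrightarrow>
    (\<exists>i j k. 1 \<le> i \<and> i < j \<and> j < k \<and> k \<le> n \<and>
      (\<forall>a<3. \<forall>b<3. \<sigma> ([i, j, k] ! a) < \<sigma> ([i, j, k] ! b) \<longleftrightarrow> [x, y, w] ! a < [x, y, w] ! b))"
  (is "?L \<longleftrightarrow> ?R")
proof
  assume ?L
  then obtain \<iota> :: "nat \<Rightarrow> nat" where
    mono: "strict_mono_on {..<3} \<iota>" and range: "\<iota> ` {..<3} \<subseteq> {1..n}" and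
    pat: "\<forall>a<3. \<forall>b<3. \<sigma> (\<iota> a) < \<sigma> (\<iota> b) \<longleftrightarrow> [x, y, w] ! a < [x, y, w] ! b"
    by (auto simp: contains_pattern_def numeral_3_eq_3)
  have "\<iota> 0 < \<iota> 1" "\<iota> 1 < \<iota> 2"
    using mono by (auto simp: strict_mono_on_def)
  moreover have "\<iota> 0 \<in> {1..n}" "\<iota> 2 \<in> {1..n}"
    using range by (auto simp: image_subset_iff)
  moreover have "[\<iota> 0, \<iota> 1, \<iota> 2] ! a = \<iota> a" if "a < 3" for a
    using that by (auto simp: less_Suc_eq numeral_3_eq_3 numeral_2_eq_2 One_nat_def)
  ultimately show ?R
    using pat by (intro exI[of _ "\<iota> 0"] exI[of _ "\<iota> 1"] exI[of _ "\<iota> 2"]) auto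
next
  assume ?R
  then obtain i j k where "1 \<le> i" "i < j" "j < k" "k \<le> n" and
    "\<forall>a<3. \<forall>b<3. \<sigma> ([i, j, k] ! a) < \<sigma> ([i, j, k] ! b) \<longleftrightarrow> [x, y, w] ! a < [x, y, w] ! b"
    by blast
  then show ?L
    unfolding contains_pattern_def
    by (intro exI[of _ "\<lambda>a. [i, j, k] ! a"])
       (auto simp: strict_mono_on_def less_Suc_eq numeral_3_eq_3)
qed

text \<open>Both patterns end in their least entry, and they realise the two possible orders of the
  two entries before it. Forbidding both therefore leaves no condition on the order of
  \<open>\<sigma> i\<close> and \<open>\<sigma> j\<close>.\<close>

lemma avoiders_321_231_iff:
  "\<sigma> \<in> avoiders [3, 2, 1] [2, 3, 1] n \<longleftrightarrow> \<sigma> permutes {1..n} \<and>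
    (\<forall>i j k. 1 \<le> i \<longrightarrow> i < j \<longrightarrow> j < k \<longrightarrow> k \<le> n \<longrightarrow> \<not> (\<sigma> k < \<sigma> i \<and> \<sigma> k < \<sigma> j))"
proof (cases "\<sigma> permutes {1..n}")
  case True
  have "contains_pattern n \<sigma> [3, 2, 1] \<or> contains_pattern n \<sigma> [2, 3, 1] \<longleftrightarrow>
    (\<exists>i j k. 1 \<le> i \<and> i < j \<and> j < k \<and> k \<le> n \<and> \<sigma> k < \<sigma> i \<and> \<sigma> k < \<sigma> j)"
    (is "_ \<longleftrightarrow> (\<exists>i j k. ?P i j k)")
  proof
    assume "contains_pattern n \<sigma> [3, 2, 1] \<or> contains_pattern n \<sigma> [2, 3, 1]"
    then show "\<exists>i j k. ?P i j k"
      unfolding contains_pattern_length3_iff all_less_3_iff by fastforce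
  next
    assume "\<exists>i j k. ?P i j k"
    then obtain i j k where P: "?P i j k"
      by blast
    then have "\<sigma> i \<noteq> \<sigma> j"
      using permutes_inj[OF True] by (auto dest: injD)
    then consider "\<sigma> i < \<sigma> j" | "\<sigma> j < \<sigma> i"
      by linarith
    then show "contains_pattern n \<sigma> [3, 2, 1] \<or> contains_pattern n \<sigma> [2, 3, 1]"
    proof cases
      case 1
      with P have "contains_pattern n \<sigma> [2, 3, 1]"
        unfolding contains_pattern_length3_iff all_less_3_iff
        by (intro exI[of _ i] exI[of _ j] exI[of _ k]) auto
      then show ?thesis ..
    next
      case 2
      with P have "contains_pattern n \<sigma> [3, 2, 1]"
        unfolding contains_pattern_length3_iff all_less_3_iff
        by (intro exI[of _ i] exI[of _ j] exI[of _ k]) auto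
      then show ?thesis ..
    qed
  qed
  then show ?thesis
    using True unfolding avoiders_def by blast
qed (simp add: avoiders_def)

lemma finite_avoiders: "finite (avoiders \<tau>1 \<tau>2 n)"
  by (rule finite_subset[OF _ finite_permutations[of "{1..n}"]]) (auto simp: avoiders_def)

lemma finite_crossings: "finite (crossings n \<sigma>)"
  by (rule finite_subset[of _ "{1..n} \<times> {1..n}"]) (auto simp: crossings_def)

section \<open>Building avoiders of size \<open>n + 1\<close> from those of size
  \<open>n\<close>\<close>

lemma permutes_Suc_fixed:
  assumes "\<sigma> permutes {1..Suc n}" "\<sigma> (Suc n) = Suc n"
  shows "\<sigma> permutes {1..n}"
  using assms by (intro permutes_superset[OF assms(1)]) (auto simp: atLeastAtMostSuc_conv)

lemma permutes_Suc:
  assumes "\<sigma> permutes {1..n}"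
  shows "\<sigma> permutes {1..Suc n}"
  using assms by (rule permutes_subset) auto

lemma avoiders_321_231_Suc_fixed:
  "{\<sigma> \<in> avoiders [3, 2, 1] [2, 3, 1] (Suc n). \<sigma> (Suc n) = Suc n} =
    avoiders [3, 2, 1] [2, 3, 1] n"
proof (intro equalityI subsetI)
  fix \<sigma> assume "\<sigma> \<in> {\<sigma> \<in> avoiders [3, 2, 1] [2, 3, 1] (Suc n). \<sigma> (Suc n) = Suc n}"
  then show "\<sigma> \<in> avoiders [3, 2, 1] [2, 3, 1] n"
    by (auto simp: avoiders_321_231_iff intro: permutes_Suc_fixed)
next
  fix \<sigma> assume A: "\<sigma> \<in> avoiders [3, 2, 1] [2, 3, 1] n"
  then have p: "\<sigma> permutes {1..n}"
    by (simp add: avoiders_321_231_iff)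
  have fixed: "\<sigma> (Suc n) = Suc n"
    using p by (auto intro: permutes_not_in)
  have le: "\<sigma> i \<le> Suc n" if "1 \<le> i" "i \<le> Suc n" for i
    using permutes_in_image[OF permutes_Suc[OF p], of i] that by auto
  show "\<sigma> \<in> {\<sigma> \<in> avoiders [3, 2, 1] [2, 3, 1] (Suc n). \<sigma> (Suc n) = Suc n}"
    using A fixed le permutes_Suc[OF p]
    by (fastforce simp: avoiders_321_231_iff le_Suc_eq not_less)
qed

lemma transpose_comp_apply_last:
  assumes "\<tau> permutes {1..n}"
  shows "(transpose n (Suc n) \<circ> \<tau>) (Suc n) = n"
  using assms by (auto simp: permutes_not_in)

lemma transpose_comp_apply:
  assumes "\<tau> permutes {1..n}" "i \<in> {1..n}"
  shows "(transpose n (Suc n) \<circ> \<tau>) i = (if \<tau> i = n then Suc n else \<tau> i)"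
  using permutes_in_image[OF assms(1), of i] assms(2) by (auto simp: transpose_def)

text \<open>The composition raises the old maximum \<open>n\<close> to \<open>Suc n\<close>, which
  preserves the relative order on the old positions. The new last entry is \<open>n\<close>, and
  only the raised value exceeds it. For \<open>n = 0\<close> the transposition would move the point
  0 outside \<open>{1..1}\<close>.\<close>

lemma avoiders_321_231_transpose_iff:
  assumes "n \<ge> 1" and p: "\<tau> permutes {1..n}"
  shows "transpose n (Suc n) \<circ> \<tau> \<in> avoiders [3, 2, 1] [2, 3, 1] (Suc n) \<longleftrightarrow>
    \<tau> \<in> avoiders [3, 2, 1] [2, 3, 1] n"
proof -
  let ?\<sigma> = "transpose n (Suc n) \<circ> \<tau>"
  have p': "?\<sigma> permutes {1..Suc n}"
    using assms by (intro permutes_compose permutes_Suc permutes_swap_id) auto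
  have le: "\<tau> i \<le> n" if "1 \<le> i" "i \<le> n" for i
    using permutes_in_image[OF p, of i] that by auto
  have mono: "?\<sigma> i < ?\<sigma> j \<longleftrightarrow> \<tau> i < \<tau> j" if "1 \<le> i" "i \<le> n" "1 \<le> j" "j \<le> n" for i j
    using that le[of i] le[of j] by (simp add: transpose_comp_apply[OF p] del: comp_apply)
  \<comment> \<open>Two earlier entries above \<open>n\<close> would both equal
    \<open>Suc n\<close>, against injectivity.\<close>
  have "\<not> (?\<sigma> (Suc n) < ?\<sigma> i \<and> ?\<sigma> (Suc n) < ?\<sigma> j)" if "1 \<le> i" "i < j" "j \<le> n" for i j
  proof -
    have "\<tau> i \<noteq> \<tau> j"
      using permutes_inj[OF p] that by (auto dest: injD)
    then show ?thesis
      using that le[of i] le[of j]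
      by (auto simp: transpose_comp_apply[OF p] transpose_comp_apply_last[OF p]
          simp del: comp_apply)
  qed
  then have "(\<forall>i j k. 1 \<le> i \<longrightarrow> i < j \<longrightarrow> j < k \<longrightarrow> k \<le> Suc n \<longrightarrow>
      \<not> (?\<sigma> k < ?\<sigma> i \<and> ?\<sigma> k < ?\<sigma> j)) \<longleftrightarrow>
    (\<forall>i j k. 1 \<le> i \<longrightarrow> i < j \<longrightarrow> j < k \<longrightarrow> k \<le> n \<longrightarrow> \<not> (?\<sigma> k < ?\<sigma> i \<and> ?\<sigma> k < ?\<sigma> j))"
    by (metis le_Suc_eq less_Suc_eq_le)
  also have "\<dots> \<longleftrightarrow>
    (\<forall>i j k. 1 \<le> i \<longrightarrow> i < j \<longrightarrow> j < k \<longrightarrow> k \<le> n \<longrightarrow> \<not> (\<tau> k < \<tau> i \<and> \<tau> k < \<tau> j))"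
    by (intro arg_cong[of _ _ All] ext) (simp add: mono del: comp_apply cong: imp_cong)
  finally show ?thesis
    using p p' by (simp only: avoiders_321_231_iff simp_thms)
qed

text \<open>A last entry below \<open>n\<close> would be preceded by the two larger entries
  \<open>n\<close> and \<open>Suc n\<close>, which is forbidden. So a last entry other than
  \<open>Suc n\<close> must be \<open>n\<close>.\<close>

lemma avoiders_321_231_Suc_not_fixed:
  assumes "n \<ge> 1"
  shows "{\<sigma> \<in> avoiders [3, 2, 1] [2, 3, 1] (Suc n). \<sigma> (Suc n) \<noteq> Suc n} =
    (\<circ>) (transpose n (Suc n)) ` avoiders [3, 2, 1] [2, 3, 1] n"
proof (intro equalityI subsetI)
  fix \<sigma> assume "\<sigma> \<in> {\<sigma> \<in> avoiders [3, 2, 1] [2, 3, 1] (Suc n). \<sigma> (Suc n) \<noteq> Suc n}"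
  then have A: "\<sigma> \<in> avoiders [3, 2, 1] [2, 3, 1] (Suc n)" and nf: "\<sigma> (Suc n) \<noteq> Suc n"
    by auto
  have p: "\<sigma> permutes {1..Suc n}"
    using A by (simp add: avoiders_321_231_iff)
  have last: "\<sigma> (Suc n) = n"
  proof (rule ccontr)
    assume "\<sigma> (Suc n) \<noteq> n"
    moreover have "\<sigma> (Suc n) \<in> {1..Suc n}"
      using permutes_in_image[OF p] by simp
    ultimately have small: "\<sigma> (Suc n) < n"
      using nf by auto
    obtain i j where ij: "i \<in> {1..Suc n}" "\<sigma> i = n" "j \<in> {1..Suc n}" "\<sigma> j = Suc n"
      using permutes_image[OF p] assms
      by (metis (no_types, lifting) atLeastAtMost_iff image_iff le_Suc_eq le_refl)
    then have "i \<noteq> j" "i \<noteq> Suc n" "j \<noteq> Suc n"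
      using nf small by auto
    then show False
      using A ij small unfolding avoiders_321_231_iff
      by (metis atLeastAtMost_iff le_Suc_eq le_imp_less_Suc less_Suc_eq linorder_neqE_nat)
  qed
  \<comment> \<open>The transposition is its own inverse, so the preimage of \<open>\<sigma>\<close>
    is obtained by applying it once more.\<close>
  let ?\<tau> = "transpose n (Suc n) \<circ> \<sigma>"
  have "?\<tau> permutes {1..Suc n}"
    using p assms by (intro permutes_compose permutes_swap_id) auto
  then have p\<tau>: "?\<tau> permutes {1..n}"
    by (rule permutes_Suc_fixed) (simp add: last)
  have \<sigma>: "\<sigma> = transpose n (Suc n) \<circ> ?\<tau>"
    by (simp add: fun_eq_iff)
  then have "?\<tau> \<in> avoiders [3, 2, 1] [2, 3, 1] n"
    using avoiders_321_231_transpose_iff[OF assms p\<tau>] A by simp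
  with \<sigma> show "\<sigma> \<in> (\<circ>) (transpose n (Suc n)) ` avoiders [3, 2, 1] [2, 3, 1] n"
    by blast
next
  fix \<sigma> assume "\<sigma> \<in> (\<circ>) (transpose n (Suc n)) ` avoiders [3, 2, 1] [2, 3, 1] n"
  then obtain \<tau> where \<tau>: "\<tau> \<in> avoiders [3, 2, 1] [2, 3, 1] n" "\<sigma> = transpose n (Suc n) \<circ> \<tau>"
    by blast
  then have p: "\<tau> permutes {1..n}"
    by (simp add: avoiders_321_231_iff)
  show "\<sigma> \<in> {\<sigma> \<in> avoiders [3, 2, 1] [2, 3, 1] (Suc n). \<sigma> (Suc n) \<noteq> Suc n}"
    using avoiders_321_231_transpose_iff[OF assms p] transpose_comp_apply_last[OF p] \<tau> by simp
qed

section \<open>Effect of the two constructions on crossings\<close>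

lemma cr_Suc_fixed:
  assumes "\<sigma> permutes {1..n}"
  shows "cr (Suc n) \<sigma> = cr n \<sigma>"
proof -
  have "\<sigma> (Suc n) = Suc n"
    using assms by (auto intro: permutes_not_in)
  moreover have "\<sigma> i \<le> Suc n" if "1 \<le> i" "i \<le> Suc n" for i
    using permutes_in_image[OF permutes_Suc[OF assms], of i] that by auto
  \<comment> \<open>With \<open>j = Suc n\<close>, a crossing would need
    \<open>Suc n < \<sigma> i\<close> or \<open>Suc n \<le> i < Suc n\<close>; and
    \<open>i = Suc n\<close> leaves no room for \<open>j\<close>.\<close>
  ultimately have "crossings (Suc n) \<sigma> = crossings n \<sigma>"
    unfolding crossings_def by (fastforce simp: le_Suc_eq)
  then show ?thesis
    by (simp add: cr_def)
qed

lemma crossings_Suc_transpose: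
  assumes "n \<ge> 1" and p: "\<tau> permutes {1..n}"
  shows "crossings (Suc n) (transpose n (Suc n) \<circ> \<tau>) =
    crossings n \<tau> \<union> (if \<tau> n = n then {} else {(n, Suc n)})"
proof -
  let ?\<sigma> = "transpose n (Suc n) \<circ> \<tau>"
  have le: "\<tau> i \<le> n" if "1 \<le> i" "i \<le> n" for i
    using permutes_in_image[OF p, of i] that by auto
  have "(i, j) \<in> crossings (Suc n) ?\<sigma> \<longleftrightarrow>
    (i, j) \<in> crossings n \<tau> \<union> (if \<tau> n = n then {} else {(n, Suc n)})" for i j
  proof (cases "i \<in> {1..n} \<and> j \<in> {1..n}")
    \<comment> \<open>Within the old positions, the raised maximum can occur in a crossing only as
      the value at \<open>j\<close> in \<open>i < j < \<sigma> i < \<sigma> j\<close>, and raising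
      it keeps these inequalities. The other kind of crossing has
      \<open>\<sigma> j \<le> i < n\<close>.\<close>
    case True
    then show ?thesis
      using le[of i] le[of j]
      by (auto simp: crossings_def transpose_comp_apply[OF p] simp del: comp_apply)
  next
    case False
    show ?thesis
    proof (cases "i \<in> {1..n} \<and> j = Suc n")
      \<comment> \<open>The value at \<open>j = Suc n\<close> is \<open>n\<close>. The first kind of
        crossing would need a value above \<open>Suc n\<close>; the second needs
        \<open>n \<le> i < Suc n\<close>, so \<open>i = n\<close>, and a value below
        \<open>n\<close> there. This fails exactly when \<open>\<tau> n = n\<close>, since that
        value is raised to \<open>Suc n\<close>.\<close>
      case True
      then show ?thesis
        using le[of i] le[of n] assms(1)
        by (auto simp: crossings_def transpose_comp_apply[OF p] transpose_comp_apply_last[OF p]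
            simp del: comp_apply)
    next
      case not_last: False
      then show ?thesis
        using False assms(1) by (auto simp: crossings_def le_Suc_eq)
    qed
  qed
  then show ?thesis
    by (intro set_eqI) (metis surj_pair)
qed

lemma cr_Suc_transpose:
  assumes "n \<ge> 1" "\<tau> permutes {1..n}"
  shows "cr (Suc n) (transpose n (Suc n) \<circ> \<tau>) = (if \<tau> n = n then cr n \<tau> else Suc (cr n \<tau>))"
proof -
  have "(n, Suc n) \<notin> crossings n \<tau>"
    by (auto simp: crossings_def)
  then show ?thesis
    unfolding cr_def crossings_Suc_transpose[OF assms] by (simp add: finite_crossings)
qed

section \<open>Recurrence for the coefficients and the generating function\<close>

definition crossing_poly :: "'a::comm_ring_1 \<Rightarrow> nat \<Rightarrow> 'a" where
  "crossing_poly q n = (\<Sum>\<sigma>\<in>avoiders [3, 2, 1] [2, 3, 1] n. q ^ cr n \<sigma>)"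

text \<open>The recurrence uses this at two sizes: for the permutations obtained by appending a
  fixed point, and for the correction term coming from those \<open>\<tau>\<close> that already fix
  their last point.\<close>

lemma sum_avoiders_321_231_Suc_fixed:
  "(\<Sum>\<sigma> | \<sigma> \<in> avoiders [3, 2, 1] [2, 3, 1] (Suc n) \<and> \<sigma> (Suc n) = Suc n. q ^ cr (Suc n) \<sigma>) =
    crossing_poly q n"
  unfolding crossing_poly_def avoiders_321_231_Suc_fixed
  by (intro sum.cong refl) (simp add: avoiders_321_231_iff cr_Suc_fixed)

lemma crossing_poly_0: "crossing_poly q 0 = 1"
proof -
  have "avoiders [3, 2, 1] [2, 3, 1] 0 = {id}"
    by (auto simp: avoiders_321_231_iff)
  then show ?thesis
    by (simp add: crossing_poly_def cr_def crossings_def)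
qed

text \<open>The transposition construction starts at \<open>n = 1\<close>, so index 1 is a second
  initial value. The only permutation of \<open>{1..1}\<close> fixes its last point, which reduces
  the sum to index 0.\<close>

lemma crossing_poly_1: "crossing_poly q (Suc 0) = 1"
proof -
  have "\<sigma> (Suc 0) = Suc 0" if "\<sigma> \<in> avoiders [3, 2, 1] [2, 3, 1] (Suc 0)" for \<sigma>
    using that permutes_in_image[of \<sigma> "{1..Suc 0}" "Suc 0"] by (simp add: avoiders_321_231_iff)
  then have "{\<sigma> \<in> avoiders [3, 2, 1] [2, 3, 1] (Suc 0). \<sigma> (Suc 0) = Suc 0} =
      avoiders [3, 2, 1] [2, 3, 1] (Suc 0)"
    by blast
  then show ?thesis
    using sum_avoiders_321_231_Suc_fixed[of q 0]
    by (simp only: crossing_poly_0) (simp add: crossing_poly_def)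
qed

lemma crossing_poly_rec:
  "crossing_poly q (Suc (Suc m)) = (1 + q) * crossing_poly q (Suc m) + (1 - q) * crossing_poly q m"
proof -
  let ?A = "avoiders [3, 2, 1] [2, 3, 1]" and ?n = "Suc m"
  let ?t = "transpose ?n (Suc ?n)"
  have inj: "inj_on ((\<circ>) ?t) (?A ?n)"
    by (rule inj_onI) (metis comp_assoc id_comp transpose_comp_involutory)
  have "(\<Sum>\<sigma> | \<sigma> \<in> ?A (Suc ?n) \<and> \<sigma> (Suc ?n) \<noteq> Suc ?n. q ^ cr (Suc ?n) \<sigma>) =
      (\<Sum>\<tau>\<in>?A ?n. q ^ cr (Suc ?n) (?t \<circ> \<tau>))"
    using avoiders_321_231_Suc_not_fixed[of ?n] by (simp add: sum.reindex[OF inj])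
  \<comment> \<open>Each \<open>\<tau>\<close> is first weighted as if the new crossing always
    appeared; where it does not, the identity \<open>1 = q + (1 - q)\<close> supplies the
    correction.\<close>
  also have "\<dots> = (\<Sum>\<tau>\<in>?A ?n. q * q ^ cr ?n \<tau> + (if \<tau> ?n = ?n then (1 - q) * q ^ cr ?n \<tau> else 0))"
    by (intro sum.cong refl)
       (simp add: avoiders_321_231_iff cr_Suc_transpose algebra_simps del: comp_apply)
  also have "\<dots> = q * crossing_poly q ?n + (1 - q) * crossing_poly q m"
    by (simp add: sum.distrib sum_distrib_left sum.inter_filter[OF finite_avoiders, symmetric]
        crossing_poly_def[of q ?n] sum_avoiders_321_231_Suc_fixed[of q m, symmetric])
  finally have not_fixed: "(\<Sum>\<sigma> | \<sigma> \<in> ?A (Suc ?n) \<and> \<sigma> (Suc ?n) \<noteq> Suc ?n. q ^ cr (Suc ?n) \<sigma>) = \<dots>" .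
  have "crossing_poly q (Suc ?n) =
      (\<Sum>\<sigma> | \<sigma> \<in> ?A (Suc ?n) \<and> \<sigma> (Suc ?n) = Suc ?n. q ^ cr (Suc ?n) \<sigma>) +
      (\<Sum>\<sigma> | \<sigma> \<in> ?A (Suc ?n) \<and> \<sigma> (Suc ?n) \<noteq> Suc ?n. q ^ cr (Suc ?n) \<sigma>)"
    unfolding crossing_poly_def
    by (subst sum.union_disjoint[symmetric]) (auto simp: finite_avoiders intro!: sum.cong)
  then show ?thesis
    by (simp only: not_fixed sum_avoiders_321_231_Suc_fixed) (simp add: algebra_simps)
qed

theorem mainTheorem6:
  fixes q :: "'a::field"
  shows "crossing_gf [3, 2, 1] [2, 3, 1] q =
    (1 - fps_const q * fps_X) /
    (1 - (1 + fps_const q) * fps_X - (1 - fps_const q) * fps_X ^ 2)"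
proof -
  let ?F = "crossing_gf [3, 2, 1] [2, 3, 1] q"
  let ?D = "1 - (1 + fps_const q) * fps_X - (1 - fps_const q) * fps_X ^ 2 :: 'a fps"
  have nth: "fps_nth ?F n = crossing_poly q n" for n
    by (simp add: crossing_gf_def crossing_poly_def)
  \<comment> \<open>Nested products with \<open>fps_X\<close> make every term a plain shift of the
    coefficients of \<open>?F\<close>.\<close>
  have expand: "?F * ?D = ?F - fps_const (1 + q) * (fps_X * ?F) -
      fps_const (1 - q) * (fps_X * (fps_X * ?F))"
    by (simp add: algebra_simps power2_eq_square flip: fps_const_add fps_const_sub)
  have "fps_nth (?F * ?D) n = fps_nth (1 - fps_const q * fps_X) n" for n
  proof (cases n)
    case 0
    then show ?thesis
      by (simp add: expand nth crossing_poly_0)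
  next
    \<comment> \<open>At index 1 the coefficient is \<open>1 - (1 + q) = - q\<close>, as the double
      shift contributes 0 there; from index 2 on the recurrence makes it vanish.\<close>
    case (Suc n')
    then show ?thesis
      by (cases n') (simp_all add: expand nth crossing_poly_0 crossing_poly_1 crossing_poly_rec)
  qed
  then have "?F * ?D = 1 - fps_const q * fps_X"
    by (simp add: fps_eq_iff)
  \<comment> \<open>The constant coefficient of \<open>?D\<close> is 1, so \<open>?D\<close> can be
    cancelled in the quotient.\<close>
  moreover have "?D \<noteq> 0"
  proof
    assume "?D = 0"
    then have "fps_nth ?D 0 = 0"
      by (simp only: fps_zero_nth)
    then show False
      by simp
  qed
  ultimately show ?thesis
    by (metis nonzero_mult_div_cancel_right)
qed

end
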